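(* Let $S$ be a double interchange semigroup with operations $\triangle$ and $\blacktriangle$. Then for all $a,b,c,d,e,f,g,h,i,j \in S$, $$((a \triangle b)\blacktriangle (c \triangle (d \blacktriangle e)))\triangle (((f \blacktriangle g)\triangle h )\blacktriangle (i \triangle j)) = ((a \triangle b)\blacktriangle (c \triangle (g \blacktriangle e)))\triangle (((f \blacktriangle d)\triangle h )\blacktriangle (i \triangle j)).$$
   Context: A double interchange semigroup is a nonempty set $S$ with two binary operations $\triangle, \blacktriangle \colon S\times S\to S$, each of which is associative, and which satisfy the interchange law $(a \triangle b)\blacktriangle(c\triangle d) = (a\blacktriangle c)\triangle(b\blacktriangle d)$ for all $a,b,c,d\in S$. No unit elements are assumed. *)

theory Defs
  imports Main
begin

(* \<nabla> stands for the solid (black) triangle, which has no Isabelle symbol. *)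

locale double_interchange_semigroup =
  fixes S :: "'a set"
    and h_op :: "'a \<Rightarrow> 'a \<Rightarrow> 'a" (infixl \<open>\<triangle>\<close> 70)
    and v_op :: "'a \<Rightarrow> 'a \<Rightarrow> 'a" (infixl \<open>\<nabla>\<close> 70)
  assumes nonempty: "S \<noteq> {}"
    and h_closed: "\<lbrakk>a \<in> S; b \<in> S\<rbrakk> \<Longrightarrow> a \<triangle> b \<in> S"
    and v_closed: "\<lbrakk>a \<in> S; b \<in> S\<rbrakk> \<Longrightarrow> a \<nabla> b \<in> S"
    and h_assoc: "\<lbrakk>a \<in> S; b \<in> S; c \<in> S\<rbrakk> \<Longrightarrow> (a \<triangle> b) \<triangle> c = a \<triangle> (b \<triangle> c)"
    and v_assoc: "\<lbrakk>a \<in> S; b \<in> S; c \<in> S\<rbrakk> \<Longrightarrow> (a \<nabla> b) \<nabla> c = a \<nabla> (b \<nabla> c)"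
    and interchange: "\<lbrakk>a \<in> S; b \<in> S; c \<in> S; d \<in> S\<rbrakk>
      \<Longrightarrow> (a \<triangle> b) \<nabla> (c \<triangle> d) = (a \<nabla> c) \<triangle> (b \<nabla> d)"

end

theory Submission
  imports Defs
begin

text \<open>
  Picture \<open>x \<triangle> y\<close> as \<open>x\<close> to the left of \<open>y\<close>, and \<open>x \<nabla> y\<close> as \<open>x\<close> below \<open>y\<close>. By the interchange
  law both sides of the identity are stacks of two horizontal rows, with entries
  \<open>a, b, f/g, h\<close> in the bottom row and \<open>c, d/e, i, j\<close> in the top row for the left-hand side,
  where \<open>x/y\<close> is the column with \<open>x\<close> below \<open>y\<close>, and with \<open>d\<close> and \<open>g\<close> exchanged for the
  right-hand side.

  The two rows need not be aligned entry by entry: an interior entry \<open>p\<close> of the bottom row can be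
  placed under any interior entry \<open>q\<close> of the top row, since the remaining parts to the left and to
  the right are again stacks of two nonempty rows. Hence the topmost factor of a bottom entry may be
  moved to the underside of a top entry, both interior, and back; this is \<open>slide_between_rows\<close>. In the present
  rows \<open>f/g\<close>, \<open>d/e\<close> and \<open>i\<close> are interior, so \<open>e\<close>, \<open>i\<close> and the column on \<open>f\<close> act like three
  stacks on which \<open>d\<close> and \<open>g\<close> are shunted: with \<open>i\<close> as a siding for \<open>d\<close>, the factor \<open>g\<close> gets
  from \<open>f\<close> to \<open>e\<close>, after which \<open>d\<close> takes its place on \<open>f\<close>.
\<close>

context double_interchange_semigroup
begin

text \<open>
  Both sides equal \<open>(l \<nabla> l') \<triangle> (p \<nabla> x \<nabla> q) \<triangle> (r \<nabla> r')\<close>, where associativity makes \<open>x\<close>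
  belong to \<open>p\<close> and \<open>q\<close> alike. The outer factors \<open>l\<close>, \<open>l'\<close>, \<open>r\<close>, \<open>r'\<close> may themselves be products
  of any lengths, which is what frees \<open>p\<close> and \<open>q\<close> from standing at equal positions of their rows.
\<close>

lemma slide_between_rows:
  assumes "l \<in> S" "p \<in> S" "r \<in> S" "l' \<in> S" "q \<in> S" "r' \<in> S" "x \<in> S"
  shows "(l \<triangle> p \<triangle> r) \<nabla> (l' \<triangle> (x \<nabla> q) \<triangle> r') = (l \<triangle> (p \<nabla> x) \<triangle> r) \<nabla> (l' \<triangle> q \<triangle> r')"
proof -
  have "(l \<triangle> p \<triangle> r) \<nabla> (l' \<triangle> (x \<nabla> q) \<triangle> r') = (l \<nabla> l') \<triangle> (p \<nabla> (x \<nabla> q)) \<triangle> (r \<nabla> r')"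
    using assms by (simp add: interchange h_closed v_closed)
  also have "\<dots> = (l \<nabla> l') \<triangle> ((p \<nabla> x) \<nabla> q) \<triangle> (r \<nabla> r')"
    using assms by (simp add: v_assoc)
  also have "\<dots> = (l \<triangle> (p \<nabla> x) \<triangle> r) \<nabla> (l' \<triangle> q \<triangle> r')"
    using assms by (simp add: interchange h_closed v_closed)
  finally show ?thesis .
qed

end

theorem theorem5p4:
  fixes S :: "'a set"
    and h_op :: "'a \<Rightarrow> 'a \<Rightarrow> 'a" (infixl \<open>\<triangle>\<close> 70)
    and v_op :: "'a \<Rightarrow> 'a \<Rightarrow> 'a" (infixl \<open>\<nabla>\<close> 70)
    and a b c d e f g h i j :: 'a
  assumes "double_interchange_semigroup S (\<triangle>) (\<nabla>)"
    and "a \<in> S" "b \<in> S" "c \<in> S" "d \<in> S" "e \<in> S"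
    and "f \<in> S" "g \<in> S" "h \<in> S" "i \<in> S" "j \<in> S"
  shows "((a \<triangle> b) \<nabla> (c \<triangle> (d \<nabla> e))) \<triangle> (((f \<nabla> g) \<triangle> h) \<nabla> (i \<triangle> j))
       = ((a \<triangle> b) \<nabla> (c \<triangle> (g \<nabla> e))) \<triangle> (((f \<nabla> d) \<triangle> h) \<nabla> (i \<triangle> j))"
proof -
  interpret double_interchange_semigroup S "(\<triangle>)" "(\<nabla>)" by fact
  note mem = assms(2-)
  have rows: "((a \<triangle> b) \<nabla> (c \<triangle> (x \<nabla> e))) \<triangle> (((f \<nabla> y) \<triangle> h) \<nabla> (i \<triangle> j))
      = ((a \<triangle> b) \<triangle> (f \<nabla> y) \<triangle> h) \<nabla> (c \<triangle> (x \<nabla> e) \<triangle> (i \<triangle> j))"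
    if "x \<in> S" "y \<in> S" for x y
    using mem that by (simp add: interchange [symmetric] h_assoc h_closed v_closed)
  have "((a \<triangle> b) \<nabla> (c \<triangle> (d \<nabla> e))) \<triangle> (((f \<nabla> g) \<triangle> h) \<nabla> (i \<triangle> j))
      = ((a \<triangle> b) \<triangle> (f \<nabla> g) \<triangle> h) \<nabla> (c \<triangle> (d \<nabla> e) \<triangle> (i \<triangle> j))"
    using mem by (simp add: rows)
  \<comment> \<open>A slide changes the row, so \<open>d\<close> gets from \<open>e\<close> to \<open>i\<close> by way of the column on \<open>f\<close>.\<close>
  also have "\<dots> = ((a \<triangle> b) \<triangle> (f \<nabla> g \<nabla> d) \<triangle> h) \<nabla> (c \<triangle> e \<triangle> (i \<triangle> j))"
    using mem by (intro slide_between_rows h_closed v_closed)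
  also have "\<dots> = ((a \<triangle> b) \<triangle> (f \<nabla> g \<nabla> d) \<triangle> h) \<nabla> (c \<triangle> e \<triangle> i \<triangle> j)"
    using mem by (simp add: h_assoc h_closed)
  also have "\<dots> = ((a \<triangle> b) \<triangle> (f \<nabla> g) \<triangle> h) \<nabla> (c \<triangle> e \<triangle> (d \<nabla> i) \<triangle> j)"
    using mem by (intro slide_between_rows [symmetric] h_closed v_closed)
  also have "\<dots> = ((a \<triangle> b) \<triangle> (f \<nabla> g) \<triangle> h) \<nabla> (c \<triangle> e \<triangle> ((d \<nabla> i) \<triangle> j))"
    using mem by (simp add: h_assoc h_closed v_closed)
  also have "\<dots> = ((a \<triangle> b) \<triangle> f \<triangle> h) \<nabla> (c \<triangle> (g \<nabla> e) \<triangle> ((d \<nabla> i) \<triangle> j))"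
    using mem by (intro slide_between_rows [symmetric] h_closed v_closed)
  also have "\<dots> = ((a \<triangle> b) \<triangle> f \<triangle> h) \<nabla> (c \<triangle> (g \<nabla> e) \<triangle> (d \<nabla> i) \<triangle> j)"
    using mem by (simp add: h_assoc h_closed v_closed)
  also have "\<dots> = ((a \<triangle> b) \<triangle> (f \<nabla> d) \<triangle> h) \<nabla> (c \<triangle> (g \<nabla> e) \<triangle> i \<triangle> j)"
    using mem by (intro slide_between_rows h_closed v_closed)
  also have "\<dots> = ((a \<triangle> b) \<triangle> (f \<nabla> d) \<triangle> h) \<nabla> (c \<triangle> (g \<nabla> e) \<triangle> (i \<triangle> j))"
    using mem by (simp add: h_assoc h_closed v_closed)
  also have "\<dots> = ((a \<triangle> b) \<nabla> (c \<triangle> (g \<nabla> e))) \<triangle> (((f \<nabla> d) \<triangle> h) \<nabla> (i \<triangle> j))"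
    using mem by (simp add: rows)
  finally show ?thesis .
qed

end
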